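(* Let $f:M\to\mathbb{S}^3\times\mathbb{S}^3$, $f=(p,q)$, be a Lagrangian immersion into the nearly Kähler manifold $\mathbb{S}^3\times\mathbb{S}^3$ with angle functions $\theta_1,\theta_2,\theta_3$ and eigenvectors $E_1,E_2,E_3$. Then $f^*:M\to\mathbb{S}^3\times\mathbb{S}^3$ given by $f^*=(\bar p,q\bar p)$, where $\bar p$ denotes the quaternionic conjugate of $p$, satisfies: (i) $f^*$ is a Lagrangian immersion; (ii) $f$ and $f^*$ induce the same metric on $M$; (iii) $E_1,E_2,E_3$ are also eigendirections of the operators $A^*,B^*$ corresponding to the immersion $f^*$, and the angle functions $\theta_1^*,\theta_2^*,\theta_3^*$ of $f^*$ (with $\theta_i^*$ corresponding to $E_i$) are given by $\theta_i^*=\frac{2\pi}{3}-\theta_i$ for $i=1,2,3$.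
   Context: Identify $\mathbb{S}^3$ with the unit quaternions in $\mathbb{H}\cong\mathbb{R}^4$, with Euclidean metric $\langle\cdot,\cdot\rangle$; tangent vectors at $p$ are $p\alpha$ with $\alpha$ an imaginary quaternion. For $(U,V)\in T_{(p,q)}(\mathbb{S}^3\times\mathbb{S}^3)\cong T_p\mathbb{S}^3\oplus T_q\mathbb{S}^3$ define the almost complex structure $$J(U,V)_{(p,q)}=\tfrac{1}{\sqrt3}\left(2pq^{-1}V-U,\,-2qp^{-1}U+V\right),$$ and the metric $g(Z,Z')=\frac12(\langle Z,Z'\rangle+\langle JZ,JZ'\rangle)$, where $\langle\cdot,\cdot\rangle$ is the usual Euclidean product metric on $\mathbb{S}^3\times\mathbb{S}^3$. With $(g,J)$, $\mathbb{S}^3\times\mathbb{S}^3$ is a nearly Kähler manifold. Define also the almost product structure $P(U,V)_{(p,q)}=(pq^{-1}V,\,qp^{-1}U)$. An immersion $f:M\to\mathbb{S}^3\times\mathbb{S}^3$ is Lagrangian if $\dim M=3$ and $J$ maps $df(T_xM)$ into the $g$-normal space for every $x\in M$. $M$ carries the metric induced from $g$ by $f$. For a Lagrangian immersion there are symmetric endomorphisms $A,B$ of $TM$ (the operators corresponding to $f$) with $P\,df(X)=df(AX)+J\,df(BX)$; they commute and satisfy $A^2+B^2=\mathrm{Id}$. Hence around each point of an open dense subset of $M$ there is a local orthonormal frame $E_1,E_2,E_3$ (the eigenvectors) and functions $\theta_1,\theta_2,\theta_3$ (the angle functions, each determined modulo $\pi$) such that $AE_i=\cos(2\theta_i)E_i$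 and $BE_i=\sin(2\theta_i)E_i$, i.e. $P\,df(E_i)=\cos(2\theta_i)\,df(E_i)+\sin(2\theta_i)\,J\,df(E_i)$, for $i=1,2,3$. Equalities between angle functions are understood modulo $\pi$. *)

theory Defs
  imports "HOL-Analysis.Analysis" "HOL-Library.Real_Mod"
begin

section \<open>Quaternions\<close>

text \<open>
  A quaternion is a pair of its real part and its imaginary part in \<open>\<real>\<^sup>3\<close>. The inner product and the
  norm that the library puts on this product type are the Euclidean ones of \<open>\<real>\<^sup>4\<close>.
\<close>

type_synonym quat = "real \<times> (real ^ 3)"

definition qmult :: "quat \<Rightarrow> quat \<Rightarrow> quat" (infixl \<open>\<odot>\<close> 70) where
  "x \<odot> y = (fst x * fst y - snd x \<bullet> snd y,
            fst x *\<^sub>R snd y + fst y *\<^sub>R snd x + cross3 (snd x) (snd y))"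

definition qcnj :: "quat \<Rightarrow> quat" where
  "qcnj x = (fst x, - snd x)"

definition qinv :: "quat \<Rightarrow> quat" where
  "qinv x = (1 / (norm x)\<^sup>2) *\<^sub>R qcnj x"


section \<open>The nearly Kaehler structure on the product of two 3-spheres\<close>

definition S3xS3 :: "(quat \<times> quat) set" where
  "S3xS3 = {(p, q). norm p = 1 \<and> norm q = 1}"

definition tangent_S3 :: "quat \<Rightarrow> quat set" where
  "tangent_S3 p = {p \<odot> \<alpha> | \<alpha>. fst \<alpha> = 0}"

definition tangent_S3xS3 :: "quat \<times> quat \<Rightarrow> (quat \<times> quat) set" where
  "tangent_S3xS3 = (\<lambda>(p, q). {(U, V). U \<in> tangent_S3 p \<and> V \<in> tangent_S3 q})"

definition Jst :: "quat \<times> quat \<Rightarrow> quat \<times> quat \<Rightarrow> quat \<times> quat" where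
  "Jst = (\<lambda>(p, q) (U, V). (1 / sqrt 3) *\<^sub>R
     (2 *\<^sub>R (p \<odot> qinv q \<odot> V) - U, - (2 *\<^sub>R (q \<odot> qinv p \<odot> U)) + V))"

definition Pst :: "quat \<times> quat \<Rightarrow> quat \<times> quat \<Rightarrow> quat \<times> quat" where
  "Pst = (\<lambda>(p, q) (U, V). (p \<odot> qinv q \<odot> V, q \<odot> qinv p \<odot> U))"

definition gst :: "quat \<times> quat \<Rightarrow> quat \<times> quat \<Rightarrow> quat \<times> quat \<Rightarrow> real" where
  "gst pq Z Z' = (Z \<bullet> Z' + Jst pq Z \<bullet> Jst pq Z') / 2"


section \<open>Smooth manifolds\<close>

text \<open>
  \<open>Ck_on k S f\<close> is meant for open \<open>S\<close> in a Euclidean space: \<open>f\<close> is of class \<open>C\<^sup>k\<close> on \<open>S\<close>.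
\<close>

primrec Ck_on :: "nat \<Rightarrow> 'a::euclidean_space set \<Rightarrow> ('a \<Rightarrow> 'b::real_normed_vector) \<Rightarrow> bool" where
  "Ck_on 0 S f \<longleftrightarrow> continuous_on S f"
| "Ck_on (Suc k) S f \<longleftrightarrow>
     f differentiable_on S \<and> (\<forall>v. Ck_on k S (\<lambda>x. frechet_derivative f (at x) v))"

definition smooth_on :: "'a::euclidean_space set \<Rightarrow> ('a \<Rightarrow> 'b::real_normed_vector) \<Rightarrow> bool" where
  "smooth_on S f \<longleftrightarrow> (\<forall>k. Ck_on k S f)"

type_synonym ('m, 'e) chart = "'m set \<times> ('m \<Rightarrow> 'e)"

definition is_chart :: "'m topology \<Rightarrow> ('m, 'e::euclidean_space) chart \<Rightarrow> bool" where
  "is_chart T = (\<lambda>(U, \<phi>). openin T U \<and> open (\<phi> ` U) \<and>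
     homeomorphic_map (subtopology T U) (top_of_set (\<phi> ` U)) \<phi>)"

text \<open>The dimension of the manifold is that of the model space \<open>'e\<close>; the atlas need not be maximal.\<close>

definition smooth_manifold :: "'m topology \<Rightarrow> ('m, 'e::euclidean_space) chart set \<Rightarrow> bool" where
  "smooth_manifold T \<A> \<longleftrightarrow>
     Hausdorff_space T \<and> second_countable T \<and>
     (\<forall>c\<in>\<A>. is_chart T c) \<and> \<Union> (fst ` \<A>) = topspace T \<and>
     (\<forall>(U, \<phi>)\<in>\<A>. \<forall>(V, \<psi>)\<in>\<A>. smooth_on (\<phi> ` (U \<inter> V)) (\<psi> \<circ> inv_into U \<phi>))"

definition smooth_map_on ::
    "('m, 'e::euclidean_space) chart set \<Rightarrow> 'm set \<Rightarrow> ('m \<Rightarrow> 'b::real_normed_vector) \<Rightarrow> bool" where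
  "smooth_map_on \<A> W f \<longleftrightarrow> (\<forall>(U, \<phi>)\<in>\<A>. smooth_on (\<phi> ` (U \<inter> W)) (f \<circ> inv_into U \<phi>))"

text \<open>
  Tangent vectors at \<open>x\<close> are the derivations at \<open>x\<close> of the algebra of smooth functions. Since HOL
  functions are total, a derivation is required to be \<open>0\<close> on functions that are not smooth. What a
  smooth function does outside \<open>topspace T\<close> is irrelevant: if \<open>h\<close> vanishes on \<open>topspace T\<close>, then
  \<open>h = h \<cdot> e\<close> with \<open>e\<close> the (smooth) indicator of the complement, so the Leibniz rule gives \<open>X h = 0\<close>.
\<close>

type_synonym 'm tvec = "('m \<Rightarrow> real) \<Rightarrow> real"

definition tangent_space ::
    "'m topology \<Rightarrow> ('m, 'e::euclidean_space) chart set \<Rightarrow> 'm \<Rightarrow> 'm tvec set" where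
  "tangent_space T \<A> x = {X.
     (\<forall>h k a b. smooth_map_on \<A> (topspace T) h \<longrightarrow> smooth_map_on \<A> (topspace T) k \<longrightarrow>
        X (\<lambda>y. a * h y + b * k y) = a * X h + b * X k) \<and>
     (\<forall>h k. smooth_map_on \<A> (topspace T) h \<longrightarrow> smooth_map_on \<A> (topspace T) k \<longrightarrow>
        X (\<lambda>y. h y * k y) = h x * X k + X h * k x) \<and>
     (\<forall>h. \<not> smooth_map_on \<A> (topspace T) h \<longrightarrow> X h = 0)}"

definition tcomb :: "real \<Rightarrow> 'm tvec \<Rightarrow> real \<Rightarrow> 'm tvec \<Rightarrow> 'm tvec" where
  "tcomb a X b Y = (\<lambda>h. a * X h + b * Y h)"

definition tscale :: "real \<Rightarrow> 'm tvec \<Rightarrow> 'm tvec" where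
  "tscale a X = (\<lambda>h. a * X h)"

text \<open>
  For a map \<open>f\<close> into a Euclidean space \<open>'b\<close>, with \<open>T\<^sub>y'b\<close> identified with \<open>'b\<close>, the vector \<open>df(X)\<close>
  has as components the derivatives along \<open>X\<close> of the components of \<open>f\<close>.
\<close>

definition differential :: "('m \<Rightarrow> 'b::euclidean_space) \<Rightarrow> 'm tvec \<Rightarrow> 'b" where
  "differential f X = (\<Sum>b\<in>Basis. X (\<lambda>y. f y \<bullet> b) *\<^sub>R b)"


section \<open>Lagrangian immersions\<close>

definition immersion_S3xS3 ::
    "'m topology \<Rightarrow> ('m, 'e::euclidean_space) chart set \<Rightarrow> ('m \<Rightarrow> quat \<times> quat) \<Rightarrow> bool" where
  "immersion_S3xS3 T \<A> f \<longleftrightarrow>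
     f ` topspace T \<subseteq> S3xS3 \<and> smooth_map_on \<A> (topspace T) f \<and>
     (\<forall>x\<in>topspace T. inj_on (differential f) (tangent_space T \<A> x))"

definition normal_space ::
    "'m topology \<Rightarrow> ('m, 'e::euclidean_space) chart set \<Rightarrow> ('m \<Rightarrow> quat \<times> quat) \<Rightarrow> 'm
     \<Rightarrow> (quat \<times> quat) set" where
  "normal_space T \<A> f x = {Z \<in> tangent_S3xS3 (f x).
     \<forall>X\<in>tangent_space T \<A> x. gst (f x) Z (differential f X) = 0}"

definition lagrangian_immersion ::
    "'m topology \<Rightarrow> ('m, 'e::euclidean_space) chart set \<Rightarrow> ('m \<Rightarrow> quat \<times> quat) \<Rightarrow> bool" where
  "lagrangian_immersion T \<A> f \<longleftrightarrow>
     immersion_S3xS3 T \<A> f \<and> DIM('e) = 3 \<and>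
     (\<forall>x\<in>topspace T.
        Jst (f x) ` differential f ` tangent_space T \<A> x \<subseteq> normal_space T \<A> f x)"

definition induced_metric ::
    "('m \<Rightarrow> quat \<times> quat) \<Rightarrow> 'm \<Rightarrow> 'm tvec \<Rightarrow> 'm tvec \<Rightarrow> real" where
  "induced_metric f x X Y = gst (f x) (differential f X) (differential f Y)"

definition symmetric_endomorphism ::
    "'m topology \<Rightarrow> ('m, 'e::euclidean_space) chart set \<Rightarrow> ('m \<Rightarrow> quat \<times> quat)
     \<Rightarrow> ('m \<Rightarrow> 'm tvec \<Rightarrow> 'm tvec) \<Rightarrow> bool" where
  "symmetric_endomorphism T \<A> f A \<longleftrightarrow>
     (\<forall>x\<in>topspace T. \<forall>X\<in>tangent_space T \<A> x. \<forall>Y\<in>tangent_space T \<A> x.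
        A x X \<in> tangent_space T \<A> x \<and>
        (\<forall>a b. A x (tcomb a X b Y) = tcomb a (A x X) b (A x Y)) \<and>
        induced_metric f x (A x X) Y = induced_metric f x X (A x Y))"

text \<open>
  For a Lagrangian immersion these operators are unique on tangent vectors, because \<open>df\<close> is injective
  and \<open>J\<close> maps the image of \<open>df\<close> to its normal space.
\<close>

definition corresponding_operators ::
    "'m topology \<Rightarrow> ('m, 'e::euclidean_space) chart set \<Rightarrow> ('m \<Rightarrow> quat \<times> quat)
     \<Rightarrow> ('m \<Rightarrow> 'm tvec \<Rightarrow> 'm tvec) \<Rightarrow> ('m \<Rightarrow> 'm tvec \<Rightarrow> 'm tvec) \<Rightarrow> bool" where
  "corresponding_operators T \<A> f A B \<longleftrightarrow>
     symmetric_endomorphism T \<A> f A \<and> symmetric_endomorphism T \<A> f B \<and>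
     (\<forall>x\<in>topspace T. \<forall>X\<in>tangent_space T \<A> x.
        Pst (f x) (differential f X) =
          differential f (A x X) + Jst (f x) (differential f (B x X)))"

definition smooth_vector_field_on ::
    "'m topology \<Rightarrow> ('m, 'e::euclidean_space) chart set \<Rightarrow> 'm set \<Rightarrow> ('m \<Rightarrow> 'm tvec) \<Rightarrow> bool" where
  "smooth_vector_field_on T \<A> W E \<longleftrightarrow>
     (\<forall>x\<in>W. E x \<in> tangent_space T \<A> x) \<and>
     (\<forall>h. smooth_map_on \<A> (topspace T) h \<longrightarrow> smooth_map_on \<A> W (\<lambda>x. E x h))"

text \<open>The indices 1, 2, 3 are taken as natural numbers; values at other indices play no role.\<close>

definition orthonormal_frame_on ::
    "'m topology \<Rightarrow> ('m, 'e::euclidean_space) chart set \<Rightarrow> ('m \<Rightarrow> quat \<times> quat) \<Rightarrow> 'm set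
     \<Rightarrow> (nat \<Rightarrow> 'm \<Rightarrow> 'm tvec) \<Rightarrow> bool" where
  "orthonormal_frame_on T \<A> f W E \<longleftrightarrow>
     openin T W \<and>
     (\<forall>i\<in>{1..3}. smooth_vector_field_on T \<A> W (E i)) \<and>
     (\<forall>x\<in>W. \<forall>i\<in>{1..3}. \<forall>j\<in>{1..3}.
        induced_metric f x (E i x) (E j x) = (if i = j then 1 else 0))"

definition angle_functions_on ::
    "'m set \<Rightarrow> ('m \<Rightarrow> 'm tvec \<Rightarrow> 'm tvec) \<Rightarrow> ('m \<Rightarrow> 'm tvec \<Rightarrow> 'm tvec)
     \<Rightarrow> (nat \<Rightarrow> 'm \<Rightarrow> 'm tvec) \<Rightarrow> (nat \<Rightarrow> 'm \<Rightarrow> real) \<Rightarrow> bool" where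
  "angle_functions_on W A B E \<theta> \<longleftrightarrow>
     (\<forall>x\<in>W. \<forall>i\<in>{1..3}.
        A x (E i x) = tscale (cos (2 * \<theta> i x)) (E i x) \<and>
        B x (E i x) = tscale (sin (2 * \<theta> i x)) (E i x))"

definition dual_map :: "('m \<Rightarrow> quat \<times> quat) \<Rightarrow> 'm \<Rightarrow> quat \<times> quat" where
  "dual_map f = (\<lambda>x. (qcnj (fst (f x)), snd (f x) \<odot> qcnj (fst (f x))))"

end

theory Submission
  imports Defs
begin

text \<open>
  The dual immersion is \<open>\<Phi> \<circ> f\<close> for the map \<open>\<Phi>(p, q) = (p\<^sup>*, q p\<^sup>*)\<close> of \<open>S\<^sup>3 \<times> S\<^sup>3\<close> to itself, \<open>p\<^sup>*\<close> being
  the conjugate of \<open>p\<close>, so that everything follows from how \<open>d\<Phi>\<close> interacts with \<open>g\<close>, \<open>J\<close> and \<open>P\<close>.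
  Write a tangent vector at \<open>(p, q)\<close> as \<open>(p\<alpha>, q\<beta>)\<close> with imaginary \<open>\<alpha>, \<beta>\<close>. In this left
  trivialisation \<open>J\<close>, \<open>P\<close> and \<open>g\<close> have constant coefficients:
  \<open>J(\<alpha>, \<beta>) = (2\<beta> - \<alpha>, \<beta> - 2\<alpha>) / \<surd>3\<close> and \<open>P(\<alpha>, \<beta>) = (\<beta>, \<alpha>)\<close>. Moreover \<open>d\<Phi>\<close> becomes
  \<open>(\<alpha>, \<beta>) \<mapsto> (- \<alpha>, \<beta> - \<alpha>)\<close> followed by the rotation \<open>\<alpha> \<mapsto> p \<alpha> p\<^sup>*\<close> in both components; a rotation
  commutes with every map that has constant coefficients. What remains is linear algebra with
  2-by-2 matrices: \<open>d\<Phi>\<close> is an isometry (\<open>gst_dual_deriv\<close>), it anticommutes with \<open>J\<close>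
  (\<open>Jst_dual_deriv\<close>), and it turns \<open>P\<close> into \<open>- P / 2 + (\<surd>3 / 2) J P\<close> (\<open>Pst_dual_deriv\<close>).

  The isometry gives equality of the induced metrics, and together with anticommutation it gives the
  Lagrangian condition. Substituting \<open>P df X = df (A X) + J df (B X)\<close> into the third relation shows
  that \<open>A\<^sup>* = - A / 2 - (\<surd>3 / 2) B\<close> and \<open>B\<^sup>* = - (\<surd>3 / 2) A + B / 2\<close> are operators for the dual
  (\<open>corresponding_operators_dual\<close>). On a common eigenvector these are the subtraction formulas for
  \<open>4\<pi>/3 - 2\<theta>\<close>. The operators of a Lagrangian immersion are unique on tangent vectors
  (\<open>corresponding_operators_unique\<close>), which carries the conclusion over to any other choice, and the
  cosine and sine of \<open>2\<theta>\<close> determine \<open>\<theta>\<close> modulo \<open>\<pi>\<close>.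

  To speak of \<open>d\<Phi>\<close> on derivations, the differential needs a product rule. Because \<open>\<Phi>\<close> is the sum of a
  linear and a quadratic map, linearity and the Leibniz rule suffice, once it
  is known that smooth functions are closed under bilinear operations.
\<close>

section \<open>Quaternion algebra\<close>

lemma bounded_bilinear_qmult: "bounded_bilinear (\<odot>)"
proof -
  have "bilinear (\<odot>)"
    unfolding bilinear_def qmult_def
    by (auto intro!: linearI simp: algebra_simps inner_simps cross3_simps)
  then show ?thesis
    by (simp add: bilinear_conv_bounded_bilinear)
qed

interpretation qmult: bounded_bilinear "(\<odot>)"
  by (rule bounded_bilinear_qmult)

lemma qcnj_add: "qcnj (x + y) = qcnj x + qcnj y"
  and qcnj_scaleR: "qcnj (c *\<^sub>R x) = c *\<^sub>R qcnj x"
  by (simp_all add: qcnj_def)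

lemma qmult_assoc: "(x \<odot> y) \<odot> z = x \<odot> (y \<odot> z)"
  by (simp add: qmult_def prod_eq_iff vec_eq_iff forall_3 inner_vec_def sum_3 cross3_simps vector_3)

lemma qcnj_qcnj [simp]: "qcnj (qcnj x) = x"
  by (simp add: qcnj_def)

lemma qcnj_qmult: "qcnj (x \<odot> y) = qcnj y \<odot> qcnj x"
  by (simp add: qmult_def qcnj_def inner_commute cross3_simps)

lemma qcnj_imaginary: "fst \<alpha> = 0 \<Longrightarrow> qcnj \<alpha> = - \<alpha>"
  by (simp add: qcnj_def prod_eq_iff)

lemma norm_qcnj [simp]: "norm (qcnj x) = norm x"
  by (simp add: qcnj_def norm_prod_def)

lemma qcnj_qmult_cancel:
  assumes "norm p = 1"
  shows "qcnj p \<odot> (p \<odot> x) = x" and "p \<odot> (qcnj p \<odot> x) = x"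
proof -
  have eq: "(fst p)\<^sup>2 + snd p \<bullet> snd p = 1"
    using assms by (simp add: norm_prod_def power2_norm_eq_inner)
  have "qcnj p \<odot> p = (1, 0)" "p \<odot> qcnj p = (1, 0)"
    using eq by (simp_all add: qmult_def qcnj_def power2_eq_square)
  moreover have "(1, 0) \<odot> x = x"
    by (simp add: qmult_def)
  ultimately show "qcnj p \<odot> (p \<odot> x) = x" "p \<odot> (qcnj p \<odot> x) = x"
    by (simp_all flip: qmult_assoc)
qed

lemma inner_qmult_left: "(x \<odot> y) \<bullet> (x \<odot> z) = (norm x)\<^sup>2 * (y \<bullet> z)"
  unfolding power2_norm_eq_inner
  by (simp add: qmult_def inner_prod_def inner_vec_def sum_3 cross3_simps vector_3)

lemma inner_qmult_right: "(y \<odot> x) \<bullet> (z \<odot> x) = (norm x)\<^sup>2 * (y \<bullet> z)"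
  unfolding power2_norm_eq_inner
  by (simp add: qmult_def inner_prod_def inner_vec_def sum_3 cross3_simps vector_3)

lemma norm_qmult: "norm (x \<odot> y) = norm x * norm y"
proof -
  have "(norm (x \<odot> y))\<^sup>2 = (norm x * norm y)\<^sup>2"
    by (simp only: power2_norm_eq_inner inner_qmult_left power_mult_distrib)
  then show ?thesis
    by (simp add: power2_eq_iff_nonneg)
qed

text \<open>
  Multiplication by \<open>p\<^sup>*\<close> moves the tangent space at \<open>p\<close> to the one at 1, the imaginary quaternions, and
  the real part of \<open>p\<^sup>* U\<close> is \<open>U \<bullet> p\<close>.
\<close>

lemma mem_tangent_S3_iff:
  assumes "norm p = 1"
  shows "U \<in> tangent_S3 p \<longleftrightarrow> U \<bullet> p = 0"
proof -
  have re: "fst (qcnj p \<odot> U) = U \<bullet> p" for U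
    by (simp add: qmult_def qcnj_def inner_prod_def inner_commute)
  show ?thesis
  proof
    assume "U \<in> tangent_S3 p"
    then show "U \<bullet> p = 0"
      using assms re by (auto simp: tangent_S3_def qcnj_qmult_cancel simp flip: re)
  next
    assume "U \<bullet> p = 0"
    then have "U = p \<odot> (qcnj p \<odot> U)" "fst (qcnj p \<odot> U) = 0"
      using assms by (simp_all add: qcnj_qmult_cancel re)
    then show "U \<in> tangent_S3 p"
      unfolding tangent_S3_def by blast
  qed
qed

section \<open>The nearly Kaehler structure in the left trivialisation\<close>

lemma tangent_S3xS3E:
  assumes "Z \<in> tangent_S3xS3 (p, q)"
  obtains \<alpha> \<beta> where "fst \<alpha> = 0" "fst \<beta> = 0" "Z = (p \<odot> \<alpha>, q \<odot> \<beta>)"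
  using assms by (auto simp: tangent_S3xS3_def tangent_S3_def)

lemma tangent_S3xS3I:
  "fst \<alpha> = 0 \<Longrightarrow> fst \<beta> = 0 \<Longrightarrow> (p \<odot> \<alpha>, q \<odot> \<beta>) \<in> tangent_S3xS3 (p, q)"
  unfolding tangent_S3xS3_def tangent_S3_def by blast

lemma qinv_unit: "norm p = 1 \<Longrightarrow> qinv p = qcnj p"
  by (simp add: qinv_def)

lemma Jst_trivialised:
  assumes "norm p = 1" "norm q = 1"
  shows "Jst (p, q) (p \<odot> \<alpha>, q \<odot> \<beta>) =
    (p \<odot> ((1 / sqrt 3) *\<^sub>R (2 *\<^sub>R \<beta> - \<alpha>)), q \<odot> ((1 / sqrt 3) *\<^sub>R (\<beta> - 2 *\<^sub>R \<alpha>)))"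
  using assms
  by (simp add: Jst_def qinv_unit qmult_assoc qcnj_qmult_cancel qmult.scaleR_right
      qmult.diff_right)

lemma Pst_trivialised:
  assumes "norm p = 1" "norm q = 1"
  shows "Pst (p, q) (p \<odot> \<alpha>, q \<odot> \<beta>) = (p \<odot> \<beta>, q \<odot> \<alpha>)"
  using assms by (simp add: Pst_def qinv_unit qmult_assoc qcnj_qmult_cancel)

lemma gst_trivialised:
  assumes "norm p = 1" "norm q = 1"
  shows "gst (p, q) (p \<odot> \<alpha>, q \<odot> \<beta>) (p \<odot> \<alpha>', q \<odot> \<beta>') =
    4 / 3 * (\<alpha> \<bullet> \<alpha>' + \<beta> \<bullet> \<beta>') - 2 / 3 * (\<alpha> \<bullet> \<beta>' + \<beta> \<bullet> \<alpha>')"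
  using assms
  by (simp add: gst_def Jst_trivialised inner_prod_def [of "(p \<odot> _, _)"] inner_qmult_left
      inner_diff_left inner_diff_right field_simps)

lemma Jst_linear: "Jst pq (a *\<^sub>R Z + b *\<^sub>R Z') = a *\<^sub>R Jst pq Z + b *\<^sub>R Jst pq Z'"
  by (cases pq rule: prod.exhaust; cases Z rule: prod.exhaust; cases Z' rule: prod.exhaust)
     (simp add: Jst_def qmult.add_right qmult.scaleR_right algebra_simps)

lemma gst_linear_left:
  "gst pq (a *\<^sub>R Z + b *\<^sub>R Z') W = a * gst pq Z W + b * gst pq Z' W"
  unfolding gst_def Jst_linear by (simp add: inner_add_left algebra_simps add_divide_distrib)

lemma gst_minus_left: "gst pq (- Z) W = - gst pq Z W"
  using gst_linear_left [of pq "- 1" Z 0 0 W] by simp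

lemma gst_commute: "gst pq Z W = gst pq W Z"
  by (simp add: gst_def inner_commute)

text \<open>Positive definiteness holds on all of \<open>\<real>\<^sup>8\<close>, as \<open>2 g\<close> dominates the Euclidean product.\<close>

lemma gst_self_eq_0D: "gst pq Z Z = 0 \<Longrightarrow> Z = 0"
  by (simp add: gst_def add_nonneg_eq_0_iff)

lemma Jst_tangent:
  assumes "pq \<in> S3xS3" "Z \<in> tangent_S3xS3 pq"
  shows "Jst pq Z \<in> tangent_S3xS3 pq"
proof -
  obtain p q where pq: "pq = (p, q)" "norm p = 1" "norm q = 1"
    using assms(1) by (auto simp: S3xS3_def)
  obtain \<alpha> \<beta> where "fst \<alpha> = 0" "fst \<beta> = 0" "Z = (p \<odot> \<alpha>, q \<odot> \<beta>)"
    using assms(2) tangent_S3xS3E pq by metis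
  then show ?thesis
    by (simp only: pq Jst_trivialised) (intro tangent_S3xS3I; simp)
qed

lemma Jst_Jst:
  assumes "pq \<in> S3xS3" "Z \<in> tangent_S3xS3 pq"
  shows "Jst pq (Jst pq Z) = - Z"
proof -
  obtain p q where pq: "pq = (p, q)" "norm p = 1" "norm q = 1"
    using assms(1) by (auto simp: S3xS3_def)
  obtain \<alpha> \<beta> where Z: "fst \<alpha> = 0" "fst \<beta> = 0" "Z = (p \<odot> \<alpha>, q \<odot> \<beta>)"
    using assms(2) tangent_S3xS3E pq by metis
  let ?s = "1 / sqrt 3"
  have s: "?s * ?s = 1 / 3" by simp
  have 1: "?s *\<^sub>R (2 *\<^sub>R (?s *\<^sub>R (\<beta> - 2 *\<^sub>R \<alpha>)) - ?s *\<^sub>R (2 *\<^sub>R \<beta> - \<alpha>)) = (?s * ?s * 3) *\<^sub>R (- \<alpha>)"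
    by (simp only: prod_eq_iff vec_eq_iff) (simp add: algebra_simps)
  have 2: "?s *\<^sub>R (?s *\<^sub>R (\<beta> - 2 *\<^sub>R \<alpha>) - 2 *\<^sub>R (?s *\<^sub>R (2 *\<^sub>R \<beta> - \<alpha>))) = (?s * ?s * 3) *\<^sub>R (- \<beta>)"
    by (simp only: prod_eq_iff vec_eq_iff) (simp add: algebra_simps)
  show ?thesis
    unfolding pq(1) Z(3) Jst_trivialised[OF pq(2,3)] 1 2 s
    by (simp add: qmult.minus_right)
qed

section \<open>The differential of the duality\<close>

text \<open>
  Both components of \<open>\<Phi>\<close> are polynomial of degree at most 2 on all of \<open>\<real>\<^sup>8\<close>; \<open>dual_deriv (p, q)\<close> is the
  derivative of this polynomial map at \<open>(p, q)\<close>.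
\<close>

definition dual_deriv :: "quat \<times> quat \<Rightarrow> quat \<times> quat \<Rightarrow> quat \<times> quat" where
  "dual_deriv = (\<lambda>(p, q) (U, V). (qcnj U, V \<odot> qcnj p + q \<odot> qcnj U))"

definition dual_pt :: "quat \<times> quat \<Rightarrow> quat \<times> quat" where
  "dual_pt = (\<lambda>(p, q). (qcnj p, q \<odot> qcnj p))"

lemma dual_map_eq: "dual_map f x = dual_pt (f x)"
  by (simp add: dual_map_def dual_pt_def case_prod_beta)

lemma dual_pt_S3xS3: "pq \<in> S3xS3 \<Longrightarrow> dual_pt pq \<in> S3xS3"
  by (auto simp: S3xS3_def dual_pt_def norm_qmult)

lemma dual_deriv_linear:
  "dual_deriv pq (a *\<^sub>R Z + b *\<^sub>R Z') = a *\<^sub>R dual_deriv pq Z + b *\<^sub>R dual_deriv pq Z'"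
  by (cases pq rule: prod.exhaust; cases Z rule: prod.exhaust; cases Z' rule: prod.exhaust)
     (simp add: dual_deriv_def qcnj_add qcnj_scaleR qmult.add_left qmult.scaleR_left
        qmult.add_right qmult.scaleR_right algebra_simps)

lemma dual_deriv_minus: "dual_deriv pq (- Z) = - dual_deriv pq Z"
  using dual_deriv_linear[of pq "- 1" Z 0 0] by simp

text \<open>
  Injectivity holds on the whole of \<open>\<real>\<^sup>8\<close>: \<open>U\<close> can be read off from the first component, and the
  second one then yields \<open>V p\<^sup>*\<close>, from which the unit quaternion \<open>p\<^sup>*\<close> cancels.
\<close>

lemma dual_deriv_inj:
  assumes "pq \<in> S3xS3" "dual_deriv pq Z = dual_deriv pq Z'"
  shows "Z = Z'"
proof -
  obtain p q where pq: "pq = (p, q)" "norm p = 1"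
    using assms(1) by (auto simp: S3xS3_def)
  obtain U V U' V' where Z: "Z = (U, V)" "Z' = (U', V')" by (metis prod.exhaust)
  have "qcnj U = qcnj U'" and V: "V \<odot> qcnj p + q \<odot> qcnj U = V' \<odot> qcnj p + q \<odot> qcnj U'"
    using assms(2) by (auto simp: dual_deriv_def pq Z)
  then have "qcnj (qcnj U) = qcnj (qcnj U')" by simp
  then have U: "U = U'" by simp
  with V have "qcnj (V \<odot> qcnj p) = qcnj (V' \<odot> qcnj p)" by simp
  then have "p \<odot> qcnj V = p \<odot> qcnj V'" by (simp add: qcnj_qmult)
  then have "qcnj V = qcnj V'" using pq(2) qcnj_qmult_cancel(1) by metis
  then have "V = V'" using qcnj_qcnj by metis
  with U Z show ?thesis by simp
qed

definition qrot :: "quat \<Rightarrow> quat \<Rightarrow> quat" where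
  "qrot p \<alpha> = p \<odot> \<alpha> \<odot> qcnj p"

lemma qrot_linear:
  "qrot p (\<alpha> + \<beta>) = qrot p \<alpha> + qrot p \<beta>"
  "qrot p (\<alpha> - \<beta>) = qrot p \<alpha> - qrot p \<beta>"
  "qrot p (- \<alpha>) = - qrot p \<alpha>"
  "qrot p (c *\<^sub>R \<alpha>) = c *\<^sub>R qrot p \<alpha>"
  by (simp_all add: qrot_def qmult.add_left qmult.add_right qmult.diff_left qmult.diff_right
      qmult.minus_left qmult.minus_right qmult.scaleR_left qmult.scaleR_right)

lemma inner_qrot: "norm p = 1 \<Longrightarrow> qrot p \<alpha> \<bullet> qrot p \<beta> = \<alpha> \<bullet> \<beta>"
  by (simp add: qrot_def inner_qmult_left inner_qmult_right)

text \<open>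
  Left trivialisation at the image point \<open>(p\<^sup>*, q p\<^sup>*)\<close> moves the factor \<open>p\<close> across \<open>\<alpha>\<close>; for example
  \<open>(p \<alpha>)\<^sup>* = - \<alpha> p\<^sup>* = p\<^sup>* (p (- \<alpha>) p\<^sup>*)\<close>.
\<close>

lemma dual_deriv_trivialised:
  assumes "norm p = 1" "fst \<alpha> = 0"
  shows "dual_deriv (p, q) (p \<odot> \<alpha>, q \<odot> \<beta>) =
    (qcnj p \<odot> qrot p (- \<alpha>), (q \<odot> qcnj p) \<odot> qrot p (\<beta> - \<alpha>))"
  using assms
  by (simp add: dual_deriv_def qrot_def qcnj_qmult qcnj_imaginary qmult_assoc qcnj_qmult_cancel
      qmult.minus_left qmult.minus_right qmult.diff_left qmult.diff_right)

text \<open>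
  The quadratic form \<open>|\<alpha>|\<^sup>2 + |\<beta>|\<^sup>2 - \<alpha> \<bullet> \<beta>\<close>, proportional to \<open>g\<close>, does not change under
  \<open>(\<alpha>, \<beta>) \<mapsto> (- \<alpha>, \<beta> - \<alpha>)\<close>.
\<close>

lemma gst_dual_deriv:
  assumes "pq \<in> S3xS3" "Z \<in> tangent_S3xS3 pq" "Z' \<in> tangent_S3xS3 pq"
  shows "gst (dual_pt pq) (dual_deriv pq Z) (dual_deriv pq Z') = gst pq Z Z'"
proof -
  obtain p q where pq: "pq = (p, q)" "norm p = 1" "norm q = 1"
    using assms(1) by (auto simp: S3xS3_def)
  obtain \<alpha> \<beta> where Z: "fst \<alpha> = 0" "fst \<beta> = 0" "Z = (p \<odot> \<alpha>, q \<odot> \<beta>)"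
    using assms(2) tangent_S3xS3E pq by metis
  obtain \<alpha>' \<beta>' where Z': "fst \<alpha>' = 0" "fst \<beta>' = 0" "Z' = (p \<odot> \<alpha>', q \<odot> \<beta>')"
    using assms(3) tangent_S3xS3E pq by metis
  have n: "norm (qcnj p) = 1" "norm (q \<odot> qcnj p) = 1"
    using pq by (simp_all add: norm_qmult)
  have "gst (dual_pt pq) (dual_deriv pq Z) (dual_deriv pq Z') =
    4 / 3 * ((- \<alpha>) \<bullet> (- \<alpha>') + (\<beta> - \<alpha>) \<bullet> (\<beta>' - \<alpha>')) -
    2 / 3 * ((- \<alpha>) \<bullet> (\<beta>' - \<alpha>') + (\<beta> - \<alpha>) \<bullet> (- \<alpha>'))"
    using pq Z Z' n by (simp only: dual_pt_def dual_deriv_trivialised gst_trivialised inner_qrot prod.case)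
  also have "\<dots> = gst pq Z Z'"
    using pq Z Z' by (simp add: gst_trivialised inner_diff_left inner_diff_right field_simps)
  finally show ?thesis .
qed

lemma Jst_dual_deriv:
  assumes "pq \<in> S3xS3" "Z \<in> tangent_S3xS3 pq"
  shows "Jst (dual_pt pq) (dual_deriv pq Z) = - dual_deriv pq (Jst pq Z)"
proof -
  obtain p q where pq: "pq = (p, q)" "norm p = 1" "norm q = 1"
    using assms(1) by (auto simp: S3xS3_def)
  obtain \<alpha> \<beta> where Z: "fst \<alpha> = 0" "fst \<beta> = 0" "Z = (p \<odot> \<alpha>, q \<odot> \<beta>)"
    using assms(2) tangent_S3xS3E pq by metis
  have n: "norm (qcnj p) = 1" "norm (q \<odot> qcnj p) = 1"
    using pq by (simp_all add: norm_qmult)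
  (* With s left opaque both sides are polynomial in s, so that normalisation can compare them. *)
  define s where "s = 1 / sqrt 3"
  have im: "fst (s *\<^sub>R (2 *\<^sub>R \<beta> - \<alpha>)) = 0"
    using Z by simp
  have 1: "s *\<^sub>R (2 *\<^sub>R qrot p (\<beta> - \<alpha>) - qrot p (- \<alpha>)) =
      - qrot p (- (s *\<^sub>R (2 *\<^sub>R \<beta> - \<alpha>)))"
    unfolding qrot_linear by (simp add: prod_eq_iff vec_eq_iff algebra_simps)
  have 2: "s *\<^sub>R (qrot p (\<beta> - \<alpha>) - 2 *\<^sub>R qrot p (- \<alpha>)) =
      - qrot p (s *\<^sub>R (\<beta> - 2 *\<^sub>R \<alpha>) - s *\<^sub>R (2 *\<^sub>R \<beta> - \<alpha>))"
    unfolding qrot_linear by (simp add: prod_eq_iff vec_eq_iff algebra_simps)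
  show ?thesis
    unfolding pq(1) Z(3) dual_pt_def prod.case Jst_trivialised[OF pq(2,3)]
      dual_deriv_trivialised[OF pq(2) Z(1)] dual_deriv_trivialised[OF pq(2) im]
      Jst_trivialised[OF n] s_def [symmetric] 1 2
    by (simp add: qmult.minus_right)
qed

text \<open>
  Let \<open>S(\<alpha>, \<beta>) = (- \<alpha>, \<beta> - \<alpha>)\<close>, an involution. Then \<open>S P S (\<alpha>, \<beta>) = (\<alpha> - \<beta>, - \<beta>)\<close>, and comparing
  coefficients with \<open>a P + b J P\<close> forces \<open>a = - 1 / 2\<close> and \<open>b = \<surd>3 / 2\<close>. These are the cosine and the
  sine of \<open>2\<pi>/3\<close>, the source of the constant in the relation between the angles.
\<close>

lemma Pst_dual_deriv:
  assumes "pq \<in> S3xS3" "Z \<in> tangent_S3xS3 pq"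
  shows "Pst (dual_pt pq) (dual_deriv pq Z) =
    dual_deriv pq ((- 1 / 2) *\<^sub>R Pst pq Z + (sqrt 3 / 2) *\<^sub>R Jst pq (Pst pq Z))"
proof -
  obtain p q where pq: "pq = (p, q)" "norm p = 1" "norm q = 1"
    using assms(1) by (auto simp: S3xS3_def)
  obtain \<alpha> \<beta> where Z: "fst \<alpha> = 0" "fst \<beta> = 0" "Z = (p \<odot> \<alpha>, q \<odot> \<beta>)"
    using assms(2) tangent_S3xS3E pq by metis
  have n: "norm (qcnj p) = 1" "norm (q \<odot> qcnj p) = 1"
    using pq by (simp_all add: norm_qmult)
  have im: "fst (\<alpha> - \<beta>) = 0" using Z by simp
  have "(- 1 / 2) *\<^sub>R Pst pq Z + (sqrt 3 / 2) *\<^sub>R Jst pq (Pst pq Z) =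
      (p \<odot> ((- 1 / 2) *\<^sub>R \<beta> + (1 / 2) *\<^sub>R (2 *\<^sub>R \<alpha> - \<beta>)),
       q \<odot> ((- 1 / 2) *\<^sub>R \<alpha> + (1 / 2) *\<^sub>R (\<alpha> - 2 *\<^sub>R \<beta>)))"
    unfolding pq(1) Z(3) Pst_trivialised[OF pq(2,3)] Jst_trivialised[OF pq(2,3)]
    by (simp add: qmult.scaleR_right qmult.add_right qmult.diff_right)
  also have "(- 1 / 2) *\<^sub>R \<beta> + (1 / 2) *\<^sub>R (2 *\<^sub>R \<alpha> - \<beta>) = \<alpha> - \<beta>"
    by (simp add: prod_eq_iff vec_eq_iff algebra_simps)
  also have "(- 1 / 2) *\<^sub>R \<alpha> + (1 / 2) *\<^sub>R (\<alpha> - 2 *\<^sub>R \<beta>) = - \<beta>"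
    by (simp add: prod_eq_iff vec_eq_iff algebra_simps)
  finally show ?thesis
    unfolding pq(1) Z(3) dual_pt_def prod.case dual_deriv_trivialised[OF pq(2) Z(1)]
      Pst_trivialised[OF n]
    by (simp only: dual_deriv_trivialised[OF pq(2) im]) (simp add: algebra_simps)
qed

section \<open>Differentiability classes\<close>

lemma frechet_derivative_cong_open:
  assumes "open S" "x \<in> S" "\<And>y. y \<in> S \<Longrightarrow> f y = g y"
  shows "frechet_derivative f (at x) = frechet_derivative g (at x)"
proof -
  have "(f has_derivative D) (at x) \<longleftrightarrow> (g has_derivative D) (at x)" for D
    using assms has_derivative_transform_within_open[of f D x UNIV S g]
      has_derivative_transform_within_open[of g D x UNIV S f] by auto
  then show ?thesis by (simp add: frechet_derivative_def)
qed

lemma Ck_on_cong: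
  assumes "open S" "\<And>x. x \<in> S \<Longrightarrow> f x = g x"
  shows "Ck_on k S f \<longleftrightarrow> Ck_on k S g"
  using assms(2)
proof (induction k arbitrary: f g)
  case 0
  then show ?case by (simp cong: continuous_on_cong)
next
  case (Suc k)
  have "f differentiable_on S \<longleftrightarrow> g differentiable_on S"
    unfolding differentiable_on_def using Suc.prems
    by (metis differentiable_transform_within zero_less_one)
  moreover have "Ck_on k S (\<lambda>x. frechet_derivative f (at x) v) \<longleftrightarrow>
      Ck_on k S (\<lambda>x. frechet_derivative g (at x) v)" for v
    using frechet_derivative_cong_open[OF assms(1) _ Suc.prems] by (intro Suc.IH) simp
  ultimately show ?case by simp
qed

lemma Ck_on_SucD: "Ck_on (Suc k) S f \<Longrightarrow> Ck_on k S f"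
  by (induction k arbitrary: f) (auto intro: differentiable_imp_continuous_on)

lemma has_frechet_derivative_on:
  "open S \<Longrightarrow> f differentiable_on S \<Longrightarrow> x \<in> S \<Longrightarrow>
    (f has_derivative frechet_derivative f (at x)) (at x)"
  by (metis at_within_open differentiable_on_def frechet_derivative_works)

text \<open>
  \<open>Ck_on\<close> refers to the chosen derivative \<open>frechet_derivative\<close>; this rule allows any formula for the
  derivative instead, since on an open set the two agree.
\<close>

lemma Ck_on_SucI:
  assumes "open S" "\<And>x. x \<in> S \<Longrightarrow> (f has_derivative D x) (at x)"
    "\<And>v. Ck_on k S (\<lambda>x. D x v)"
  shows "Ck_on (Suc k) S f"
proof -
  have "f differentiable_on S"
    using assms(2) by (auto simp: differentiable_on_def differentiable_def intro: has_derivative_at_withinI)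
  moreover have "Ck_on k S (\<lambda>x. frechet_derivative f (at x) v)" for v
    using Ck_on_cong[OF assms(1), of "\<lambda>x. frechet_derivative f (at x) v" "\<lambda>x. D x v"]
      frechet_derivative_at[OF assms(2)] assms(3) by metis
  ultimately show ?thesis by simp
qed

lemma Ck_on_const: "open S \<Longrightarrow> Ck_on k S (\<lambda>x. c)"
proof (induction k arbitrary: c)
  case (Suc k)
  show ?case
    by (rule Ck_on_SucI[where D = "\<lambda>x v. 0"]) (use Suc in auto)
qed simp

lemma Ck_on_add:
  assumes "open S" "Ck_on k S f" "Ck_on k S g"
  shows "Ck_on k S (\<lambda>x. f x + g x)"
  using assms(2,3)
proof (induction k arbitrary: f g)
  case 0
  then show ?case by (auto intro: continuous_on_add)
next
  case (Suc k)
  show ?case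
    by (rule Ck_on_SucI[OF assms(1) has_derivative_add])
      (use Suc has_frechet_derivative_on[OF assms(1)] in auto)
qed

lemma Ck_on_bounded_linear:
  assumes "open S" "bounded_linear L" "Ck_on k S f"
  shows "Ck_on k S (\<lambda>x. L (f x))"
  using assms(3)
proof (induction k arbitrary: f)
  case 0
  then show ?case by (auto intro: bounded_linear.continuous_on[OF assms(2)])
next
  case (Suc k)
  show ?case
    by (rule Ck_on_SucI[OF assms(1) bounded_linear.has_derivative[OF assms(2)]])
      (use Suc has_frechet_derivative_on[OF assms(1)] in auto)
qed

text \<open>
  The derivative of a product is a sum of products of an original factor with a derivative, so the
  induction also uses that the factors themselves are of class \<open>C\<^sup>k\<close> (\<open>Ck_on_SucD\<close>).
\<close>

lemma Ck_on_bounded_bilinear: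
  assumes "open S" "bounded_bilinear b" "Ck_on k S f" "Ck_on k S g"
  shows "Ck_on k S (\<lambda>x. b (f x) (g x))"
  using assms(3,4)
proof (induction k arbitrary: f g)
  case 0
  then show ?case by (auto intro: bounded_bilinear.continuous_on[OF assms(2)])
next
  case (Suc k)
  show ?case
    by (rule Ck_on_SucI[OF assms(1) bounded_bilinear.FDERIV[OF assms(2)]])
      (use Suc has_frechet_derivative_on[OF assms(1)] Ck_on_SucD[of k S f] Ck_on_SucD[of k S g]
        in \<open>auto intro!: Ck_on_add[OF assms(1)]\<close>)
qed

section \<open>Smooth maps and derivations on a manifold\<close>

locale charted =
  fixes T :: "'m topology" and \<A> :: "('m, 'e::euclidean_space) chart set"
  assumes charts: "c \<in> \<A> \<Longrightarrow> is_chart T c"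
begin

abbreviation smooth :: "('m \<Rightarrow> 'b::real_normed_vector) \<Rightarrow> bool" where
  "smooth \<equiv> smooth_map_on \<A> (topspace T)"

lemma open_chart_image:
  assumes "(U, \<phi>) \<in> \<A>"
  shows "open (\<phi> ` (U \<inter> topspace T))"
  using charts[OF assms] openin_subset[of T U] by (simp add: is_chart_def Int_absorb2)

lemma inv_chart_topspace:
  "y \<in> \<phi> ` (U \<inter> topspace T) \<Longrightarrow> (U, \<phi>) \<in> \<A> \<Longrightarrow> inv_into U \<phi> y \<in> topspace T"
  using charts[of "(U, \<phi>)"] openin_subset[of T U]
  by (auto simp: is_chart_def intro!: subsetD[of U "topspace T"] inv_into_into)

lemma smoothI:
  assumes "\<And>U \<phi> k. (U, \<phi>) \<in> \<A> \<Longrightarrow>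
    Ck_on k (\<phi> ` (U \<inter> topspace T)) (\<lambda>y. f (inv_into U \<phi> y))"
  shows "smooth f"
  using assms by (auto simp: smooth_map_on_def smooth_on_def o_def)

lemma smoothD:
  assumes "smooth f" "(U, \<phi>) \<in> \<A>"
  shows "Ck_on k (\<phi> ` (U \<inter> topspace T)) (\<lambda>y. f (inv_into U \<phi> y))"
  using assms by (auto simp: smooth_map_on_def smooth_on_def o_def)

lemma smooth_map_on_cong:
  assumes eq: "\<And>x. x \<in> topspace T \<Longrightarrow> f x = g x" and f: "smooth f"
  shows "smooth g"
proof (rule smoothI)
  fix U \<phi> k assume c: "(U, \<phi>) \<in> \<A>"
  have "f (inv_into U \<phi> y) = g (inv_into U \<phi> y)" if "y \<in> \<phi> ` (U \<inter> topspace T)" for y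
    by (rule eq[OF inv_chart_topspace[OF that c]])
  then show "Ck_on k (\<phi> ` (U \<inter> topspace T)) (\<lambda>y. g (inv_into U \<phi> y))"
    using smoothD[OF f c] by (rule iffD1[OF Ck_on_cong[OF open_chart_image[OF c]]])
qed

lemma smooth_const: "smooth (\<lambda>x. c)"
  by (rule smoothI) (rule Ck_on_const[OF open_chart_image])

lemma smooth_add:
  assumes "smooth f" "smooth g"
  shows "smooth (\<lambda>x. f x + g x)"
  by (rule smoothI) (rule Ck_on_add[OF open_chart_image smoothD smoothD, OF _ assms(1) _ assms(2)])

lemma smooth_bounded_linear:
  assumes "bounded_linear L" "smooth f"
  shows "smooth (\<lambda>x. L (f x))"
  by (rule smoothI)
    (rule Ck_on_bounded_linear[OF open_chart_image assms(1) smoothD, OF _ assms(2)])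

lemma smooth_bounded_bilinear:
  assumes "bounded_bilinear b" "smooth f" "smooth g"
  shows "smooth (\<lambda>x. b (f x) (g x))"
  by (rule smoothI)
    (rule Ck_on_bounded_bilinear[OF open_chart_image assms(1) smoothD smoothD,
        OF _ assms(2) _ assms(3)])

lemma smooth_mult:
  fixes h k :: "'m \<Rightarrow> real"
  shows "smooth h \<Longrightarrow> smooth k \<Longrightarrow> smooth (\<lambda>x. h x * k x)"
  by (rule smooth_bounded_bilinear[OF bounded_bilinear_mult])

lemma smooth_component:
  fixes f :: "'m \<Rightarrow> 'b::euclidean_space"
  shows "smooth f \<Longrightarrow> smooth (\<lambda>x. f x \<bullet> b)"
  by (rule smooth_bounded_linear[OF bounded_linear_inner_left])

lemma smooth_sum:
  fixes h :: "'i \<Rightarrow> 'm \<Rightarrow> real"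
  assumes "\<And>i. i \<in> I \<Longrightarrow> smooth (h i)"
  shows "smooth (\<lambda>x. \<Sum>i\<in>I. h i x)"
  using assms by (induction I rule: infinite_finite_induct) (simp_all add: smooth_add smooth_const)

lemma derivation_linear:
  assumes "X \<in> tangent_space T \<A> x" "smooth h" "smooth k"
  shows "X (\<lambda>y. a * h y + b * k y) = a * X h + b * X k"
  using assms unfolding tangent_space_def by blast

lemma derivation_mult:
  assumes "X \<in> tangent_space T \<A> x" "smooth h" "smooth k"
  shows "X (\<lambda>y. h y * k y) = h x * X k + X h * k x"
  using assms unfolding tangent_space_def by blast

lemma derivation_const:
  assumes X: "X \<in> tangent_space T \<A> x"
  shows "X (\<lambda>y. c) = 0"
proof -
  have "X (\<lambda>y. 1) = 0"
    using derivation_mult[OF X smooth_const smooth_const, of 1 1] by simp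
  then show ?thesis
    using derivation_linear[OF X smooth_const smooth_const, of c 1 0 0] by simp
qed

text \<open>
  As \<open>d = h - k\<close> vanishes on the manifold, \<open>d = d \<cdot> e\<close> with \<open>e\<close> the indicator of the complement. Both
  factors are smooth and vanish at \<open>x\<close>, so the Leibniz rule gives \<open>X d = 0\<close>.
\<close>

lemma derivation_cong:
  assumes X: "X \<in> tangent_space T \<A> x" and "x \<in> topspace T" "smooth h"
    and eq: "\<And>y. y \<in> topspace T \<Longrightarrow> h y = k y"
  shows "X h = X k"
proof -
  let ?d = "\<lambda>y. 1 * h y + (- 1) * k y" and ?e = "\<lambda>y. if y \<in> topspace T then 0 else 1 :: real"
  have k: "smooth k"
    using eq \<open>smooth h\<close> by (rule smooth_map_on_cong)
  have d: "smooth ?d"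
    by (rule smooth_map_on_cong[OF _ smooth_const[of 0]]) (simp add: eq)
  have e: "smooth ?e"
    by (rule smooth_map_on_cong[OF _ smooth_const[of 0]]) simp
  have "?d = (\<lambda>y. ?d y * ?e y)"
    by (auto simp: eq)
  then have "X ?d = X (\<lambda>y. ?d y * ?e y)"
    by (rule arg_cong)
  also have "\<dots> = 0"
    using derivation_mult[OF X d e] assms(2) eq by simp
  finally show ?thesis
    using derivation_linear[OF X \<open>smooth h\<close> k, of 1 "- 1"] by simp
qed

lemma derivation_sum:
  fixes h :: "'i \<Rightarrow> 'm \<Rightarrow> real"
  assumes X: "X \<in> tangent_space T \<A> x" and "\<And>i. i \<in> I \<Longrightarrow> smooth (h i)"
  shows "X (\<lambda>y. \<Sum>i\<in>I. c i * h i y) = (\<Sum>i\<in>I. c i * X (h i))"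
  using assms(2)
proof (induction I rule: infinite_finite_induct)
  case (insert i I)
  have "smooth (\<lambda>y. \<Sum>i\<in>I. c i * h i y)"
    using insert.prems by (intro smooth_sum smooth_mult smooth_const) auto
  then show ?case
    using insert derivation_linear[OF X, of "h i" "\<lambda>y. \<Sum>i\<in>I. c i * h i y" "c i" 1] by simp
qed (simp_all add: derivation_const[OF X])

lemma derivation_add:
  assumes "X \<in> tangent_space T \<A> x" "smooth h" "smooth k"
  shows "X (\<lambda>y. h y + k y) = X h + X k"
  using derivation_linear[OF assms, of 1 1] by simp

text \<open>
  The differential is defined through the components along the basis; this is the same in an
  arbitrary direction \<open>c\<close>. With \<open>differential_eqI\<close> it reduces statements about differentials to
  real-valued functions.
\<close>

lemma inner_differential:
  fixes f :: "'m \<Rightarrow> 'b::euclidean_space"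
  assumes X: "X \<in> tangent_space T \<A> x" and f: "smooth f"
  shows "X (\<lambda>y. f y \<bullet> c) = differential f X \<bullet> c"
proof -
  have "(\<lambda>y. f y \<bullet> c) = (\<lambda>y. \<Sum>b\<in>Basis. (b \<bullet> c) * (f y \<bullet> b))"
    by (subst euclidean_inner) (simp add: mult.commute inner_commute)
  then show ?thesis
    using derivation_sum[OF X smooth_component[OF f], where I = Basis and c = "\<lambda>b. b \<bullet> c"]
    by (simp add: differential_def inner_sum_left mult.commute)
qed

lemma differential_eqI:
  fixes f :: "'m \<Rightarrow> 'b::euclidean_space"
  assumes "\<And>c. X (\<lambda>y. f y \<bullet> c) = Z \<bullet> c"
  shows "differential f X = Z"
  by (simp add: differential_def assms euclidean_representation)

lemma differential_add:
  fixes f g :: "'m \<Rightarrow> 'b::euclidean_space"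
  assumes "X \<in> tangent_space T \<A> x" "smooth f" "smooth g"
  shows "differential (\<lambda>y. f y + g y) X = differential f X + differential g X"
  using assms
  by (intro differential_eqI)
     (simp add: inner_add_left derivation_add[OF _ smooth_component smooth_component] inner_differential)

lemma differential_bounded_linear:
  fixes f :: "'m \<Rightarrow> 'b::euclidean_space" and L :: "'b \<Rightarrow> 'c::euclidean_space"
  assumes "X \<in> tangent_space T \<A> x" "smooth f" "bounded_linear L"
  shows "differential (\<lambda>y. L (f y)) X = L (differential f X)"
  using assms
  by (intro differential_eqI)
     (simp add: inner_differential flip: adjoint_works[OF bounded_linear.linear[OF assms(3)]])

text \<open>
  A bilinear map is a finite sum of products of coordinates, to each of which the Leibniz rule
  applies.
\<close>

lemma differential_bounded_bilinear:
  fixes f :: "'m \<Rightarrow> 'b::euclidean_space" and g :: "'m \<Rightarrow> 'c::euclidean_space"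
    and m :: "'b \<Rightarrow> 'c \<Rightarrow> 'd::euclidean_space"
  assumes X: "X \<in> tangent_space T \<A> x" and f: "smooth f" and g: "smooth g"
    and m: "bounded_bilinear m"
  shows "differential (\<lambda>y. m (f y) (g y)) X =
    m (f x) (differential g X) + m (differential f X) (g x)"
proof (rule differential_eqI)
  fix c
  interpret m: bounded_bilinear m by (rule m)
  (* The right-hand side has the shape of the left one: rewriting with uninstantiated u, v diverges. *)
  have expand: "m u v \<bullet> c = (\<Sum>(a, b)\<in>Basis \<times> Basis. (m a b \<bullet> c) * ((u \<bullet> a) * (v \<bullet> b)))" for u v
  proof -
    have 1: "m u v = (\<Sum>a\<in>Basis. (u \<bullet> a) *\<^sub>R m a v)" for u v
      by (simp add: euclidean_representation flip: m.scaleR_left m.sum_left)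
    have 2: "m u v = (\<Sum>b\<in>Basis. (v \<bullet> b) *\<^sub>R m u b)" for u v
      by (simp add: euclidean_representation flip: m.scaleR_right m.sum_right)
    have "m u v = (\<Sum>a\<in>Basis. (u \<bullet> a) *\<^sub>R (\<Sum>b\<in>Basis. (v \<bullet> b) *\<^sub>R m a b))"
      by (subst 1) (simp only: 2 [of _ v])
    then show ?thesis
      by (simp add: inner_sum_left sum_distrib_left sum.cartesian_product mult_ac case_prod_beta)
  qed
  have "X (\<lambda>y. m (f y) (g y) \<bullet> c) =
      (\<Sum>(a, b)\<in>Basis \<times> Basis. (m a b \<bullet> c) * X (\<lambda>y. (f y \<bullet> a) * (g y \<bullet> b)))"
    unfolding expand [of "f _" "g _"] case_prod_beta
    by (rule derivation_sum[OF X, where h = "\<lambda>(a, b) y. (f y \<bullet> a) * (g y \<bullet> b)", unfolded case_prod_beta])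
      (rule smooth_mult[OF smooth_component[OF f] smooth_component[OF g]])
  also have "\<dots> = (\<Sum>(a, b)\<in>Basis \<times> Basis. (m a b \<bullet> c) *
      ((f x \<bullet> a) * (differential g X \<bullet> b) + (differential f X \<bullet> a) * (g x \<bullet> b)))"
    by (simp only: derivation_mult[OF X smooth_component[OF f] smooth_component[OF g]]
        inner_differential[OF X f] inner_differential[OF X g])
  also have "\<dots> = (m (f x) (differential g X) + m (differential f X) (g x)) \<bullet> c"
    unfolding inner_add_left expand [of "f x"] expand [of _ "g x"]
    by (simp add: case_prod_beta distrib_left sum.distrib)
  finally show "X (\<lambda>y. m (f y) (g y) \<bullet> c) =
      (m (f x) (differential g X) + m (differential f X) (g x)) \<bullet> c" .
qed

text \<open>
  Differentiate the constant \<open>r \<bullet> r = 1\<close>. It is constant only on the manifold, hence the appeal to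
  \<open>derivation_cong\<close>.
\<close>

lemma differential_sphere:
  fixes r :: "'m \<Rightarrow> 'b::euclidean_space"
  assumes X: "X \<in> tangent_space T \<A> x" and x: "x \<in> topspace T" and r: "smooth r"
    and n: "\<And>y. y \<in> topspace T \<Longrightarrow> norm (r y) = 1"
  shows "differential r X \<bullet> r x = 0"
proof -
  have "smooth (\<lambda>y. r y \<bullet> r y)"
    by (rule smooth_bounded_bilinear[OF bounded_bilinear_inner r r])
  then have "X (\<lambda>y. r y \<bullet> r y) = X (\<lambda>y. 1)"
    using n by (intro derivation_cong[OF X x]) (auto simp: norm_eq_1)
  then have "X (\<lambda>y. r y \<bullet> r y) = 0"
    by (simp add: derivation_const[OF X])
  then have "differential (\<lambda>y. r y \<bullet> r y) X = 0"
    by (simp add: differential_def)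
  then show ?thesis
    by (simp add: differential_bounded_bilinear[OF X r r bounded_bilinear_inner] inner_commute)
qed

lemma differential_tangent:
  assumes X: "X \<in> tangent_space T \<A> x" and x: "x \<in> topspace T" and f: "smooth f"
    and S: "f ` topspace T \<subseteq> S3xS3"
  shows "differential f X \<in> tangent_S3xS3 (f x)"
proof -
  have n: "norm (fst (f y)) = 1" "norm (snd (f y)) = 1" if "y \<in> topspace T" for y
    using S that by (auto simp: S3xS3_def case_prod_beta)
  have "differential (\<lambda>y. fst (f y)) X = fst (differential f X)"
    "differential (\<lambda>y. snd (f y)) X = snd (differential f X)"
    by (intro differential_bounded_linear[OF X f] bounded_linear_fst bounded_linear_snd)+
  then have "fst (differential f X) \<bullet> fst (f x) = 0" "snd (differential f X) \<bullet> snd (f x) = 0"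
    using differential_sphere[OF X x smooth_bounded_linear[OF bounded_linear_fst f]] n(1)
      differential_sphere[OF X x smooth_bounded_linear[OF bounded_linear_snd f]] n(2)
    by auto
  then show ?thesis
    using n[OF x] by (simp add: tangent_S3xS3_def case_prod_beta mem_tangent_S3_iff mem_Times_iff)
qed

text \<open>
  \<open>\<Phi>(Z) = L Z + m Z Z\<close> with \<open>L\<close> linear and \<open>m\<close> bilinear, so smoothness and the differential of the dual
  map come from the corresponding rules.
\<close>

lemma
  assumes "smooth f"
  shows smooth_dual_map: "smooth (dual_map f)"
    and differential_dual_map: "X \<in> tangent_space T \<A> x \<Longrightarrow>
      differential (dual_map f) X = dual_deriv (f x) (differential f X)"
proof -
  define L :: "quat \<times> quat \<Rightarrow> quat \<times> quat" where "L = (\<lambda>Z. (qcnj (fst Z), 0))"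
  define m :: "quat \<times> quat \<Rightarrow> quat \<times> quat \<Rightarrow> quat \<times> quat"
    where "m = (\<lambda>Z W. (0, snd Z \<odot> qcnj (fst W)))"
  have L: "bounded_linear L"
    unfolding linear_conv_bounded_linear [symmetric] L_def
    by (intro linearI) (simp_all only: fst_add fst_scaleR qcnj_add qcnj_scaleR, simp_all)
  have m: "bounded_bilinear m"
    unfolding bilinear_conv_bounded_bilinear [symmetric] bilinear_def m_def
    by (intro conjI allI linearI; simp only: fst_add snd_add fst_scaleR snd_scaleR qcnj_add qcnj_scaleR
        qmult.add_left qmult.add_right qmult.scaleR_left qmult.scaleR_right; simp)
  have eq: "dual_map f = (\<lambda>y. L (f y) + m (f y) (f y))"
    by (simp add: dual_map_def L_def m_def)
  have sL: "smooth (\<lambda>y. L (f y))" and sm: "smooth (\<lambda>y. m (f y) (f y))"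
    by (rule smooth_bounded_linear[OF L assms], rule smooth_bounded_bilinear[OF m assms assms])
  then show "smooth (dual_map f)"
    unfolding eq by (rule smooth_add)
  assume X: "X \<in> tangent_space T \<A> x"
  show "differential (dual_map f) X = dual_deriv (f x) (differential f X)"
    unfolding eq differential_add[OF X sL sm] differential_bounded_linear[OF X assms L]
      differential_bounded_bilinear[OF X assms assms m]
    by (simp add: L_def m_def dual_deriv_def case_prod_beta)
qed

lemma tcomb_tangent:
  assumes "X \<in> tangent_space T \<A> x" "Y \<in> tangent_space T \<A> x"
  shows "tcomb a X b Y \<in> tangent_space T \<A> x"
  using assms by (auto simp: tangent_space_def tcomb_def algebra_simps)

lemma zero_tangent: "(\<lambda>h. 0) \<in> tangent_space T \<A> x"
  by (simp add: tangent_space_def)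

end

lemma differential_tcomb:
  "differential f (tcomb a X b Y) = a *\<^sub>R differential f X + b *\<^sub>R differential f Y"
  by (simp add: differential_def tcomb_def scaleR_sum_right sum.distrib scaleR_add_left)

lemma differential_zero: "differential f (\<lambda>h. 0) = 0"
  by (simp add: differential_def)

lemma induced_metric_tcomb_left:
  "induced_metric f x (tcomb a X b X') Y = a * induced_metric f x X Y + b * induced_metric f x X' Y"
  by (simp add: induced_metric_def differential_tcomb gst_linear_left)

lemma induced_metric_commute: "induced_metric f x X Y = induced_metric f x Y X"
  by (simp add: induced_metric_def gst_commute)

lemma induced_metric_tcomb_right:
  "induced_metric f x Y (tcomb a X b X') = a * induced_metric f x Y X + b * induced_metric f x Y X'"
  by (metis induced_metric_commute induced_metric_tcomb_left)

section \<open>Lagrangian immersions and their duals\<close>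

locale charted_lagrangian = charted T \<A>
  for T :: "'m topology" and \<A> :: "('m, 'e::euclidean_space) chart set" +
  fixes f :: "'m \<Rightarrow> quat \<times> quat"
  assumes lagrangian: "lagrangian_immersion T \<A> f"
begin

lemma smooth_f: "smooth f"
  using lagrangian by (auto simp: lagrangian_immersion_def immersion_S3xS3_def)

lemma f_S3xS3: "f ` topspace T \<subseteq> S3xS3"
  using lagrangian by (auto simp: lagrangian_immersion_def immersion_S3xS3_def)

lemma differential_inj: "x \<in> topspace T \<Longrightarrow> inj_on (differential f) (tangent_space T \<A> x)"
  using lagrangian by (auto simp: lagrangian_immersion_def immersion_S3xS3_def)

lemma gst_Jst_differential:
  assumes "x \<in> topspace T" "X \<in> tangent_space T \<A> x" "Y \<in> tangent_space T \<A> x"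
  shows "gst (f x) (Jst (f x) (differential f X)) (differential f Y) = 0"
  using lagrangian assms by (auto simp: lagrangian_immersion_def normal_space_def)

lemma df_tangent:
  "x \<in> topspace T \<Longrightarrow> X \<in> tangent_space T \<A> x \<Longrightarrow> differential f X \<in> tangent_S3xS3 (f x)"
  by (rule differential_tangent[OF _ _ smooth_f f_S3xS3])

text \<open>
  The spaces \<open>df(T\<^sub>xM)\<close> and \<open>J df(T\<^sub>xM)\<close> are \<open>g\<close>-orthogonal, so they meet only in 0, and both \<open>df\<close> and
  \<open>J\<close> are injective there.
\<close>

lemma df_plus_J_df_eq_0D:
  assumes x: "x \<in> topspace T" and X: "X \<in> tangent_space T \<A> x" and Y: "Y \<in> tangent_space T \<A> x"
    and 0: "differential f X + Jst (f x) (differential f Y) = 0"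
  shows "X = (\<lambda>h. 0)" "Y = (\<lambda>h. 0)"
proof -
  have eq: "differential f X = - Jst (f x) (differential f Y)"
    using 0 by (simp add: eq_neg_iff_add_eq_0)
  have "gst (f x) (differential f X) (differential f X) =
      - gst (f x) (Jst (f x) (differential f Y)) (differential f X)"
    by (subst (1) eq) (rule gst_minus_left)
  then have dX: "differential f X = 0"
    using gst_Jst_differential[OF x Y X] by (intro gst_self_eq_0D[of "f x"]) simp
  have "Jst (f x) (Jst (f x) (differential f Y)) = 0"
    using 0 dX Jst_linear[of "f x" 0 0 0 0] by simp
  then have dY: "differential f Y = 0"
    using Jst_Jst[OF _ df_tangent[OF x Y]] f_S3xS3 x by (simp add: image_subset_iff)
  show "X = (\<lambda>h. 0)" "Y = (\<lambda>h. 0)"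
    using dX dY inj_onD[OF differential_inj[OF x] _ _ zero_tangent] X Y
    by (metis differential_zero)+
qed

lemma corresponding_operators_unique:
  assumes "corresponding_operators T \<A> f A B" "corresponding_operators T \<A> f A' B'"
    and x: "x \<in> topspace T" and X: "X \<in> tangent_space T \<A> x"
  shows "A x X = A' x X" "B x X = B' x X"
proof -
  have mem: "A x X \<in> tangent_space T \<A> x" "B x X \<in> tangent_space T \<A> x"
    "A' x X \<in> tangent_space T \<A> x" "B' x X \<in> tangent_space T \<A> x"
    using assms by (auto simp: corresponding_operators_def symmetric_endomorphism_def)
  have "differential f (A x X) + Jst (f x) (differential f (B x X)) =
      differential f (A' x X) + Jst (f x) (differential f (B' x X))"
    using assms by (metis corresponding_operators_def)
  then have "differential f (tcomb 1 (A x X) (- 1) (A' x X)) +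
      Jst (f x) (differential f (tcomb 1 (B x X) (- 1) (B' x X))) = 0"
    unfolding differential_tcomb Jst_linear by (simp add: algebra_simps)
  from df_plus_J_df_eq_0D[OF x tcomb_tangent tcomb_tangent this] mem
  show "A x X = A' x X" "B x X = B' x X"
    by (auto simp: tcomb_def fun_eq_iff)
qed

lemma induced_metric_dual:
  assumes "x \<in> topspace T" "X \<in> tangent_space T \<A> x" "Y \<in> tangent_space T \<A> x"
  shows "induced_metric (dual_map f) x X Y = induced_metric f x X Y"
  using assms f_S3xS3
  by (auto simp: induced_metric_def differential_dual_map[OF smooth_f] dual_map_eq
      intro!: gst_dual_deriv df_tangent)

text \<open>
  For tangent \<open>Z\<close>, \<open>W\<close> in the image of \<open>df\<close>, anticommutation and isometry give
  \<open>g(J d\<Phi> Z, d\<Phi> W) = - g(d\<Phi> (J Z), d\<Phi> W) = - g(J Z, W) = 0\<close>.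
\<close>

lemma lagrangian_dual: "lagrangian_immersion T \<A> (dual_map f)"
  unfolding lagrangian_immersion_def immersion_S3xS3_def
proof (intro conjI ballI)
  have S: "dual_map f ` topspace T \<subseteq> S3xS3"
    using f_S3xS3 by (auto simp: dual_map_eq intro!: dual_pt_S3xS3)
  then show "dual_map f ` topspace T \<subseteq> S3xS3" .
  show s: "smooth (dual_map f)"
    by (rule smooth_dual_map[OF smooth_f])
  show "DIM('e) = 3"
    using lagrangian by (simp add: lagrangian_immersion_def)
  fix x assume x: "x \<in> topspace T"
  have fx: "f x \<in> S3xS3" using f_S3xS3 x by auto
  note d = differential_dual_map[OF smooth_f, of _ x]
  show "inj_on (differential (dual_map f)) (tangent_space T \<A> x)"
    by (rule inj_onI) (metis d dual_deriv_inj[OF fx] inj_onD[OF differential_inj[OF x]])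
  show "Jst (dual_map f x) ` differential (dual_map f) ` tangent_space T \<A> x
      \<subseteq> normal_space T \<A> (dual_map f) x"
    unfolding normal_space_def
  proof (clarsimp, intro conjI ballI)
    fix X assume X: "X \<in> tangent_space T \<A> x"
    show "Jst (dual_map f x) (differential (dual_map f) X) \<in> tangent_S3xS3 (dual_map f x)"
      using S x by (intro Jst_tangent differential_tangent[OF X x s S]) auto
    fix Y assume Y: "Y \<in> tangent_space T \<A> x"
    let ?Z = "differential f X" and ?W = "differential f Y"
    have "gst (dual_pt (f x)) (- dual_deriv (f x) (Jst (f x) ?Z)) (dual_deriv (f x) ?W)
        = - gst (f x) (Jst (f x) ?Z) ?W"
      unfolding gst_minus_left
      by (simp add: gst_dual_deriv[OF fx Jst_tangent[OF fx]] df_tangent[OF x] X Y)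
    then show "gst (dual_map f x) (Jst (dual_map f x) (differential (dual_map f) X))
        (differential (dual_map f) Y) = 0"
      by (simp add: d X Y dual_map_eq Jst_dual_deriv[OF fx df_tangent[OF x X]]
          gst_Jst_differential[OF x X Y])
  qed
qed

text \<open>
  Expand \<open>P d\<Phi> (df X) = d\<Phi> (- P df X / 2 + (\<surd>3 / 2) J P df X)\<close> with \<open>P df X = df (A X) + J df (B X)\<close>
  and \<open>J\<^sup>2 = - 1\<close>. The tangential part is \<open>- A X / 2 - (\<surd>3 / 2) B X\<close>; the coefficient of the
  \<open>J\<close>-part changes its sign because \<open>d\<Phi>\<close> anticommutes with \<open>J\<close>.
\<close>

lemma corresponding_operators_dual:
  assumes "corresponding_operators T \<A> f A B"
  shows "corresponding_operators T \<A> (dual_map f)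
    (\<lambda>x X. tcomb (- 1 / 2) (A x X) (- sqrt 3 / 2) (B x X))
    (\<lambda>x X. tcomb (- sqrt 3 / 2) (A x X) (1 / 2) (B x X))"
proof -
  have AB: "symmetric_endomorphism T \<A> f A" "symmetric_endomorphism T \<A> f B"
    using assms by (auto simp: corresponding_operators_def)
  have sym: "symmetric_endomorphism T \<A> (dual_map f) (\<lambda>x X. tcomb a (A x X) b (B x X))" for a b
    unfolding symmetric_endomorphism_def
  proof (intro ballI conjI allI)
    fix x X Y c d
    assume x: "x \<in> topspace T" and X: "X \<in> tangent_space T \<A> x" and Y: "Y \<in> tangent_space T \<A> x"
    have mem: "A x Z \<in> tangent_space T \<A> x" "B x Z \<in> tangent_space T \<A> x"
      if "Z \<in> tangent_space T \<A> x" for Z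
      using AB x that by (auto simp: symmetric_endomorphism_def)
    then show m: "tcomb a (A x X) b (B x X) \<in> tangent_space T \<A> x"
      using X by (simp add: tcomb_tangent)
    have lin: "A x (tcomb c X d Y) = tcomb c (A x X) d (A x Y)"
      "B x (tcomb c X d Y) = tcomb c (B x X) d (B x Y)"
      using AB x X Y by (auto simp: symmetric_endomorphism_def)
    show "tcomb a (A x (tcomb c X d Y)) b (B x (tcomb c X d Y)) =
        tcomb c (tcomb a (A x X) b (B x X)) d (tcomb a (A x Y) b (B x Y))"
      unfolding lin by (simp add: tcomb_def algebra_simps)
    have "induced_metric f x (A x X) Y = induced_metric f x X (A x Y)"
      "induced_metric f x (B x X) Y = induced_metric f x X (B x Y)"
      using AB x X Y by (auto simp: symmetric_endomorphism_def)
    then show "induced_metric (dual_map f) x (tcomb a (A x X) b (B x X)) Y =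
        induced_metric (dual_map f) x X (tcomb a (A x Y) b (B x Y))"
      using X Y mem x
      by (simp add: induced_metric_dual tcomb_tangent induced_metric_tcomb_left
          induced_metric_tcomb_right)
  qed
  show ?thesis
    unfolding corresponding_operators_def
  proof (intro conjI sym ballI)
    fix x X assume x: "x \<in> topspace T" and X: "X \<in> tangent_space T \<A> x"
    have fx: "f x \<in> S3xS3" using f_S3xS3 x by auto
    have mem: "A x X \<in> tangent_space T \<A> x" "B x X \<in> tangent_space T \<A> x"
      using AB x X by (auto simp: symmetric_endomorphism_def)
    let ?d = "dual_deriv (f x)" and ?J = "Jst (f x)"
    let ?a = "differential f (A x X)" and ?b = "differential f (B x X)"
    have J: "Jst (dual_pt (f x)) (?d ?a) = - ?d (?J ?a)" "Jst (dual_pt (f x)) (?d ?b) = - ?d (?J ?b)"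
      by (intro Jst_dual_deriv fx df_tangent x mem)+
    have P: "Pst (f x) (differential f X) = 1 *\<^sub>R ?a + 1 *\<^sub>R ?J ?b"
      using assms x X by (simp add: corresponding_operators_def)
    have "?J (?J ?b) = - ?b"
      by (intro Jst_Jst fx df_tangent x mem)
    then show "Pst (dual_map f x) (differential (dual_map f) X) =
      differential (dual_map f) (tcomb (- 1 / 2) (A x X) (- sqrt 3 / 2) (B x X)) +
      Jst (dual_map f x)
        (differential (dual_map f) (tcomb (- sqrt 3 / 2) (A x X) (1 / 2) (B x X)))"
      unfolding dual_map_eq differential_tcomb differential_dual_map[OF smooth_f X]
        differential_dual_map[OF smooth_f mem(1)] differential_dual_map[OF smooth_f mem(2)]
        Pst_dual_deriv[OF fx df_tangent[OF x X]] P Jst_linear J dual_deriv_linear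
      by (simp add: dual_deriv_minus algebra_simps)
  qed
qed

end

text \<open>These are the eigenvalues that \<open>corresponding_operators_dual\<close> gives on a common eigenvector.\<close>

lemma cos_sin_dual_angle:
  "cos (2 * (2 * pi / 3 - t)) = - 1 / 2 * cos (2 * t) - sqrt 3 / 2 * sin (2 * t)"
  "sin (2 * (2 * pi / 3 - t)) = - sqrt 3 / 2 * cos (2 * t) + 1 / 2 * sin (2 * t)"
proof -
  have eq: "2 * (2 * pi / 3 - t) = (pi / 3 - 2 * t) + pi" by simp
  show "cos (2 * (2 * pi / 3 - t)) = - 1 / 2 * cos (2 * t) - sqrt 3 / 2 * sin (2 * t)"
    "sin (2 * (2 * pi / 3 - t)) = - sqrt 3 / 2 * cos (2 * t) + 1 / 2 * sin (2 * t)"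
    unfolding eq cos_periodic_pi sin_periodic_pi by (simp_all add: cos_diff sin_diff cos_60 sin_60)
qed

lemma double_angle_rcong_pi:
  assumes "cos (2 * s) = cos (2 * t)" "sin (2 * s) = sin (2 * t)"
  shows "[s = t] (rmod pi)"
proof -
  obtain n :: int where "2 * s = 2 * t + 2 * pi * n"
    using assms sin_cos_eq_iff[of "2 * s" "2 * t"] by metis
  then have "2 * s = 2 * (t + n * pi)" by (simp add: algebra_simps)
  then have "s = t + n * pi" by (simp only: mult_cancel_left) simp
  then show ?thesis by (auto simp: rcong_altdef intro!: exI[of _ "- n"])
qed

theorem theorem4:
  fixes T :: "'m topology" and \<A> :: "('m, 'e::euclidean_space) chart set"
    and f :: "'m \<Rightarrow> quat \<times> quat"
  assumes "smooth_manifold T \<A>"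
    and "lagrangian_immersion T \<A> f"
  shows "lagrangian_immersion T \<A> (dual_map f) \<and>
    (\<forall>x\<in>topspace T. \<forall>X\<in>tangent_space T \<A> x. \<forall>Y\<in>tangent_space T \<A> x.
       induced_metric (dual_map f) x X Y = induced_metric f x X Y) \<and>
    (\<forall>A B. corresponding_operators T \<A> f A B \<longrightarrow>
       (\<exists>A' B'. corresponding_operators T \<A> (dual_map f) A' B') \<and>
       (\<forall>A' B' W E \<theta>.
          corresponding_operators T \<A> (dual_map f) A' B' \<longrightarrow>
          orthonormal_frame_on T \<A> f W E \<longrightarrow> angle_functions_on W A B E \<theta> \<longrightarrow>
          orthonormal_frame_on T \<A> (dual_map f) W E \<and>
          angle_functions_on W A' B' E (\<lambda>i x. 2 * pi / 3 - \<theta> i x) \<and>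
          (\<forall>\<theta>'. angle_functions_on W A' B' E \<theta>' \<longrightarrow>
             (\<forall>x\<in>W. \<forall>i\<in>{1..3}. [\<theta>' i x = 2 * pi / 3 - \<theta> i x] (rmod pi)))))"
proof -
  interpret charted_lagrangian T \<A> f
    using assms by unfold_locales (auto simp: smooth_manifold_def)
  interpret dual: charted_lagrangian T \<A> "dual_map f"
    by unfold_locales (rule lagrangian_dual)
  show ?thesis
  proof (intro conjI allI impI ballI)
    fix A B assume AB: "corresponding_operators T \<A> f A B"
    note AB_dual = corresponding_operators_dual[OF AB]
    then show "\<exists>A' B'. corresponding_operators T \<A> (dual_map f) A' B'" by blast
    fix A' B' W E \<theta>
    assume AB': "corresponding_operators T \<A> (dual_map f) A' B'"
      and frame: "orthonormal_frame_on T \<A> f W E"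
      and angles: "angle_functions_on W A B E \<theta>"
    have W: "x \<in> topspace T" if "x \<in> W" for x
      using frame openin_subset that by (auto simp: orthonormal_frame_on_def)
    have E: "E i x \<in> tangent_space T \<A> x" if "x \<in> W" "i \<in> {1..3}" for i x
      using frame that by (auto simp: orthonormal_frame_on_def smooth_vector_field_on_def)
    show "orthonormal_frame_on T \<A> (dual_map f) W E"
      using frame W E by (auto simp: orthonormal_frame_on_def induced_metric_dual)
    show angles': "angle_functions_on W A' B' E (\<lambda>i x. 2 * pi / 3 - \<theta> i x)"
      unfolding angle_functions_on_def
    proof (intro ballI)
      fix x and i :: nat assume xi: "x \<in> W" "i \<in> {1..3}"
      have "A x (E i x) = tscale (cos (2 * \<theta> i x)) (E i x)"
        "B x (E i x) = tscale (sin (2 * \<theta> i x)) (E i x)"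
        using angles xi by (auto simp: angle_functions_on_def)
      then show "A' x (E i x) = tscale (cos (2 * (2 * pi / 3 - \<theta> i x))) (E i x) \<and>
          B' x (E i x) = tscale (sin (2 * (2 * pi / 3 - \<theta> i x))) (E i x)"
        unfolding dual.corresponding_operators_unique[OF AB' AB_dual W[OF xi(1)] E[OF xi]]
          cos_sin_dual_angle
        by (simp add: tcomb_def tscale_def algebra_simps)
    qed
    fix \<theta>' x and i :: nat
    assume \<theta>': "angle_functions_on W A' B' E \<theta>'" and xi: "x \<in> W" "i \<in> {1..3}"
    have "induced_metric f x (E i x) (E i x) = 1"
      using frame xi by (auto simp: orthonormal_frame_on_def)
    (* A unit vector is nonzero, hence its eigenvalues are determined. *)
    then have "E i x \<noteq> (\<lambda>h. 0)"
      using induced_metric_tcomb_left[of f x 0 "E i x" 0 "E i x" "E i x"]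
      by (auto simp: tcomb_def)
    then have "c = d" if "tscale c (E i x) = tscale d (E i x)" for c d
      using that by (auto simp: tscale_def fun_eq_iff)
    then show "[\<theta>' i x = 2 * pi / 3 - \<theta> i x] (rmod pi)"
      using \<theta>' angles' xi unfolding angle_functions_on_def
      by (intro double_angle_rcong_pi) metis+
  qed (use lagrangian_dual induced_metric_dual in auto)
qed

end
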